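(* Let $\Phi=\sum_{k=1}^{15}\Phi_k$ and $\Phi^*$ be as in the context. For each of the fifteen 8-form terms $e_{\mu_1\mu_2\cdots\mu_8}$ of $\Phi^*$ ($\mu_1<\dots<\mu_8$), consider the seven pairings of its indices $C_1=\{\mu_1\mu_2,\mu_3\mu_4,\mu_5\mu_6,\mu_7\mu_8\}$, $C_2=\{\mu_1\mu_3,\mu_2\mu_4,\mu_5\mu_7,\mu_6\mu_8\}$, $C_3=\{\mu_1\mu_4,\mu_2\mu_3,\mu_5\mu_8,\mu_6\mu_7\}$, $M_1=\{\mu_1\mu_5,\mu_2\mu_6,\mu_3\mu_7,\mu_4\mu_8\}$, $M_2=\{\mu_1\mu_6,\mu_2\mu_5,\mu_3\mu_8,\mu_4\mu_7\}$, $M_3=\{\mu_1\mu_7,\mu_2\mu_8,\mu_3\mu_5,\mu_4\mu_6\}$, $M_4=\{\mu_1\mu_8,\mu_2\mu_7,\mu_3\mu_6,\mu_4\mu_5\}$. For a pairing $\{a_1b_1,a_2b_2,a_3b_3,a_4b_4\}$ ($a_i<b_i$) and a sign pattern $(\epsilon_1,\epsilon_2,\epsilon_3,\epsilon_4)\in\{(+,+,+,+),(+,+,-,-),(+,-,+,-),(+,-,-,+)\}$, put $$R=\tfrac14(1+\epsilon_1e_{a_1b_1})(1+\epsilon_2e_{a_2b_2})(1+\epsilon_3e_{a_3b_3})(1+\epsilon_4e_{a_4b_4}),$$ a product of four commuting $90^\circ$ rotors in $\mathrm{Spin}(15)$. Then $R\Phi R^{-1}=\sum_{k=1}^{15}\eta_k\Phi_k$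 for some signs $\eta_k\in\{\pm1\}$, i.e. conjugation by $R$ permutes the fifteen 7-form terms of $\Phi$ up to sign. This yields $15\times7=105$ distinct quadruples of rotation planes ("primary invariants"), and $420$ invariants when the four sign patterns are included.
   Context: $Cl_{15}$ denotes the real Clifford algebra generated by $e_1,\dots,e_{15}$, with indices written in hexadecimal ($A=10,\dots,F=15$), subject to $e_i^2=+1$ and $e_ie_j=-e_je_i$ for $i\neq j$. For increasing indices $i_1<\dots<i_k$, $e_{i_1\cdots i_k}=e_{i_1}\cdots e_{i_k}$. The fifteen terms $\Phi_k$ of $\Phi$ are the 7-forms $e_{1234567}$, $e_{12389AB}$, $e_{14589CD}$, $e_{16789EF}$, $e_{2468ACE}$, $e_{2578ADF}$, $e_{3478BCF}$, $e_{3568BDE}$, $e_{123CDEF}$, $e_{145ABEF}$, $e_{167ABCD}$, $e_{2469BDF}$, $e_{2579BCE}$, $e_{3479ADE}$, $e_{3569ACF}$. $\Phi^*=-e_{123456789ABCDEF}\Phi$, whose fifteen terms are the 8-forms $e_{12478BDE}$, $e_{12479ACF}$, $e_{12568BCF}$, $e_{12569ADE}$, $e_{13468ADF}$, $e_{13469BCE}$, $e_{13578ACE}$, $e_{13579BDF}$, $e_{234589EF}$, $e_{2345ABCD}$, $e_{236789CD}$, $e_{2367ABEF}$, $e_{456789AB}$, $e_{4567CDEF}$, $e_{89ABCDEF}$. *)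

theory Defs
  imports Complex_Main
begin

text \<open>The real Clifford algebra Cl_15 with e_i^2 = +1, realised concretely:
  a multivector is a coefficient function on blades (index sets A \<subseteq> {1..15}).
  The basis blade e_A (A increasing) times e_B equals csign A B * e_(A symdiff B),
  where csign counts the transpositions needed to sort the concatenation.\<close>

type_synonym mv = "nat set \<Rightarrow> real"

definition Cl15 :: "mv set" where
  "Cl15 = {x. \<forall>A. x A \<noteq> 0 \<longrightarrow> A \<subseteq> {1..15}}"

definition csign :: "nat set \<Rightarrow> nat set \<Rightarrow> real" where
  "csign A B = (-1) ^ card {(a, b). a \<in> A \<and> b \<in> B \<and> b < a}"

definition clmul :: "mv \<Rightarrow> mv \<Rightarrow> mv" where
  "clmul x y = (\<lambda>C. \<Sum>A\<in>Pow {1..15}. x A * y (A - C \<union> (C - A)) * csign A (A - C \<union> (C - A)))"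

definition blade :: "nat set \<Rightarrow> mv" where
  "blade A = (\<lambda>C. if C = A then 1 else 0)"

definition clone :: mv where "clone = blade {}"

definition scal :: "real \<Rightarrow> mv \<Rightarrow> mv" where
  "scal c x = (\<lambda>C. c * x C)"

definition PhiTerms :: "nat set list" where
  "PhiTerms =
   [{1,2,3,4,5,6,7}, {1,2,3,8,9,10,11}, {1,4,5,8,9,12,13}, {1,6,7,8,9,14,15},
    {2,4,6,8,10,12,14}, {2,5,7,8,10,13,15}, {3,4,7,8,11,12,15}, {3,5,6,8,11,13,14},
    {1,2,3,12,13,14,15}, {1,4,5,10,11,14,15}, {1,6,7,10,11,12,13}, {2,4,6,9,11,13,15},
    {2,5,7,9,11,12,14}, {3,4,7,9,10,13,14}, {3,5,6,9,10,12,15}]"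

definition Phi :: mv where
  "Phi = (\<lambda>C. \<Sum>k<15. blade (PhiTerms ! k) C)"

definition PhiStar :: mv where
  "PhiStar = scal (-1) (clmul (blade {1..15}) Phi)"

text \<open>The seven pairings C1,C2,C3,M1,...,M4, as 0-based positions into the
  increasing index list mu_1 < ... < mu_8 of an 8-form term.\<close>
definition pairings :: "(nat \<times> nat) list list" where
  "pairings =
   [[(0,1),(2,3),(4,5),(6,7)],
    [(0,2),(1,3),(4,6),(5,7)],
    [(0,3),(1,2),(4,7),(5,6)],
    [(0,4),(1,5),(2,6),(3,7)],
    [(0,5),(1,4),(2,7),(3,6)],
    [(0,6),(1,7),(2,4),(3,5)],
    [(0,7),(1,6),(2,5),(3,4)]]"

definition sign_patterns :: "real list list" where
  "sign_patterns = [[1,1,1,1], [1,1,-1,-1], [1,-1,1,-1], [1,-1,-1,1]]"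

definition rot1 :: "nat \<Rightarrow> nat \<Rightarrow> real \<Rightarrow> mv" where
  "rot1 a b eps = (\<lambda>C. if C = {} then 1 else if C = {a, b} then eps else 0)"

definition rotor :: "nat list \<Rightarrow> (nat \<times> nat) list \<Rightarrow> real list \<Rightarrow> mv" where
  "rotor m P s =
     (let f = (\<lambda>i. rot1 (m ! fst (P ! i)) (m ! snd (P ! i)) (s ! i))
      in scal (1/4) (clmul (clmul (clmul (f 0) (f 1)) (f 2)) (f 3)))"

definition planes :: "nat list \<Rightarrow> (nat \<times> nat) list \<Rightarrow> nat set set" where
  "planes m P = (\<lambda>(i, j). {m ! i, m ! j}) ` set P"

end

theory Submission
  imports Defs "HOL-Library.Function_Algebras" "HOL-Combinatorics.Transposition"
begin

text \<open>A rotor \<open>1 \<plusminus> e\<^sub>a\<^sub>b\<close> conjugates the blade \<open>e\<^sub>T\<close> to \<open>\<plusminus> e\<^sub>T\<^sub>'\<close>, where \<open>T'\<close> is the image of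
  \<open>T\<close> under the transposition of \<open>a\<close> and \<open>b\<close>. Read the indices \<open>1, \<dots>, 15\<close> in binary as the
  nonzero vectors of \<open>GF(2)\<^sup>4\<close>. Then the terms of \<open>\<Phi>\<close> are the hyperplanes \<open>u \<bullet> x = 0\<close>, those of
  \<open>\<Phi>\<^sup>*\<close> are the affine hyperplanes \<open>u \<bullet> x = 1\<close>, and each of the seven pairings of an affine
  hyperplane pairs \<open>x\<close> with \<open>x + d\<close> for a fixed \<open>d\<close> with \<open>u \<bullet> d = 0\<close>. Hence the product of the four
  transpositions is the linear map \<open>x \<mapsto> x + (u \<bullet> x) d\<close>, a transvection, and it permutes the
  hyperplanes.

  The planes of a rotor are the two-element sets in its support. Their union is the 8-form term, and
  the coefficients at the planes are a quarter of the signs, so all the rotors are distinct.\<close>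

subsection \<open>Reordering signs\<close>

lemma csign_eq_prod:
  assumes "finite A" "finite B"
  shows "csign A B = (\<Prod>a\<in>A. \<Prod>b\<in>B. if b < a then -1 else 1)"
proof -
  have "csign A B = (\<Prod>p\<in>{p \<in> A \<times> B. snd p < fst p}. -1)"
    unfolding csign_def prod_constant by (rule arg_cong[where f = "\<lambda>S. (-1) ^ card S"]) auto
  also have "\<dots> = (\<Prod>p\<in>A \<times> B. if snd p < fst p then -1 else 1)"
    using assms by (intro prod.inter_filter) auto
  also have "\<dots> = (\<Prod>a\<in>A. \<Prod>b\<in>B. if b < a then -1 else 1)"
    by (simp add: prod.cartesian_product case_prod_beta)
  finally show ?thesis .
qed

lemma csign_in_signs: "csign A B \<in> {1, -1}"
  unfolding csign_def by (simp add: minus_one_power_iff)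

lemma csign_mult_self [simp]: "csign A B * csign A B = 1"
  using csign_in_signs[of A B] by auto

lemma csign_empty [simp]: "csign {} B = 1" "csign A {} = 1"
  by (simp_all add: csign_def)

lemma prod_sym_diff:
  fixes g :: "'a \<Rightarrow> 'b::comm_monoid_mult"
  assumes "finite A" "finite B" "\<And>x. g x * g x = 1"
  shows "prod g (sym_diff A B) = prod g A * prod g B"
proof -
  have "prod g A * prod g B
      = (prod g (A \<inter> B) * prod g (A \<inter> B)) * (prod g (A - B) * prod g (B - A))"
    using assms prod.Int_Diff[of A g B] prod.Int_Diff[of B g A]
    by (simp add: Int_commute mult_ac)
  also have "prod g (A \<inter> B) * prod g (A \<inter> B) = 1"
    unfolding prod.distrib[symmetric] using assms(3) by simp
  also have "1 * (prod g (A - B) * prod g (B - A)) = prod g (sym_diff A B)"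
    using assms by (subst prod.union_disjoint) auto
  finally show ?thesis by simp
qed

lemma csign_sym_diff_left:
  assumes "finite A" "finite B" "finite C"
  shows "csign (sym_diff A B) C = csign A C * csign B C"
proof -
  have "(\<Prod>b\<in>C. if b < a then -1 else 1) * (\<Prod>b\<in>C. if b < a then -1 else 1) = (1::real)" for a
    unfolding prod.distrib[symmetric] by (rule prod.neutral) simp
  then show ?thesis
    using assms by (simp add: csign_eq_prod prod_sym_diff)
qed

lemma csign_sym_diff_right:
  assumes "finite A" "finite B" "finite C"
  shows "csign C (sym_diff A B) = csign C A * csign C B"
  using assms by (simp add: csign_eq_prod prod_sym_diff flip: prod.distrib)

lemma csign_cocycle:
  assumes "finite A" "finite B" "finite C"
  shows "csign A B * csign (sym_diff A B) C = csign B C * csign A (sym_diff B C)"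
  using assms by (simp add: csign_sym_diff_left csign_sym_diff_right)

lemma csign_singleton_commute:
  assumes "finite T"
  shows "csign T {a} * csign {a} T = (-1) ^ card T * (if a \<in> T then -1 else 1)"
proof -
  have "csign T {a} * csign {a} T = (\<Prod>t\<in>T. -1 * (if t = a then -1 else 1))"
    using assms by (simp add: csign_eq_prod flip: prod.distrib) (intro prod.cong, auto)
  also have "\<dots> = (-1) ^ card T * (if a \<in> T then -1 else 1)"
    using assms unfolding prod.distrib prod_constant by simp
  finally show ?thesis .
qed

lemma csign_doubleton_commute:
  assumes "finite T" "a \<noteq> b"
  shows "csign {a, b} T = (if a \<in> T \<longleftrightarrow> b \<in> T then 1 else -1) * csign T {a, b}"
proof -
  have "{a, b} = sym_diff {a} {b}" using assms by auto
  then have "csign T {a, b} * csign {a, b} T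
      = (csign T {a} * csign {a} T) * (csign T {b} * csign {b} T)"
    using assms by (simp only: csign_sym_diff_left csign_sym_diff_right finite.intros mult_ac)
  also have "\<dots> = (if a \<in> T \<longleftrightarrow> b \<in> T then 1 else -1)"
    using assms by (simp add: csign_singleton_commute mult_ac flip: power_add)
  finally show ?thesis
    using csign_in_signs[of T "{a, b}"] by auto
qed

lemma csign_doubleton_self: "a \<noteq> b \<Longrightarrow> csign {a, b} {a, b} = -1"
  by (auto simp: csign_eq_prod)

subsection \<open>The Clifford product\<close>

lemma Cl15_zero_outside: "x \<in> Cl15 \<Longrightarrow> \<not> A \<subseteq> {1..15} \<Longrightarrow> x A = 0"
  unfolding Cl15_def by blast

lemma clmul_in_Cl15:
  assumes "y \<in> Cl15"
  shows "clmul x y \<in> Cl15"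
  unfolding Cl15_def
proof (intro CollectI allI impI)
  fix C assume "clmul x y C \<noteq> 0"
  then obtain A where "A \<in> Pow {1..15}" "x A * y (sym_diff A C) * csign A (sym_diff A C) \<noteq> 0"
    unfolding clmul_def by (rule sum.not_neutral_contains_not_neutral)
  then have "A \<subseteq> {1..15}" "sym_diff A C \<subseteq> {1..15}"
    using assms unfolding Cl15_def mult_eq_0_iff by blast+
  then show "C \<subseteq> {1..15}" by blast
qed

lemma scal_in_Cl15: "x \<in> Cl15 \<Longrightarrow> scal c x \<in> Cl15"
  by (simp add: Cl15_def scal_def)

lemma blade_in_Cl15: "A \<subseteq> {1..15} \<Longrightarrow> blade A \<in> Cl15"
  by (simp add: Cl15_def blade_def)

lemma clone_in_Cl15: "clone \<in> Cl15"
  by (simp add: clone_def blade_in_Cl15)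

lemma Cl15_cocycle:
  assumes "z \<in> Cl15" "B \<subseteq> {1..15}" "D \<subseteq> {1..15}"
  shows "z E * (csign B D * csign (sym_diff B D) E) = z E * (csign D E * csign B (sym_diff D E))"
proof (cases "E \<subseteq> {1..15}")
  case True
  with assms have "finite B" "finite D" "finite E" by (auto intro: finite_subset)
  then show ?thesis by (simp only: csign_cocycle)
next
  case False
  then show ?thesis by (simp add: Cl15_zero_outside[OF assms(1)])
qed

lemma clmul_assoc:
  assumes "z \<in> Cl15"
  shows "clmul (clmul x y) z = clmul x (clmul y z)"
proof
  fix C
  let ?U = "Pow {1..15::nat}"
  define left where "left B D = x B * y D * (z (sym_diff (sym_diff B D) C)
    * (csign B D * csign (sym_diff B D) (sym_diff (sym_diff B D) C)))" for B D
  define right where "right B D = x B * y D * (z (sym_diff D (sym_diff B C))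
    * (csign D (sym_diff D (sym_diff B C)) * csign B (sym_diff B C)))" for B D
  have cancel: "sym_diff B (sym_diff B A) = A" for A B :: "nat set" by blast
  have shift: "(\<Sum>A\<in>?U. h (sym_diff B A)) = (\<Sum>D\<in>?U. h D)"
    if "B \<in> ?U" for B and h :: "nat set \<Rightarrow> real"
    by (rule sum.reindex_bij_witness[where i = "sym_diff B" and j = "sym_diff B"])
      (use that in \<open>simp_all only: cancel, blast+\<close>)
  have left_eq_right: "left B D = right B D" if "B \<in> ?U" "D \<in> ?U" for B D
  proof -
    have "sym_diff (sym_diff B D) C = sym_diff D (sym_diff B C)" by blast
    then show ?thesis
      using that Cl15_cocycle[OF assms, of B D "sym_diff D (sym_diff B C)"]
      unfolding left_def right_def by (simp only: cancel Pow_iff)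
  qed
  have "clmul (clmul x y) z C = (\<Sum>A\<in>?U. \<Sum>B\<in>?U. left B (sym_diff B A))"
    unfolding clmul_def left_def cancel sum_distrib_right by (simp only: mult_ac)
  also have "\<dots> = (\<Sum>B\<in>?U. \<Sum>A\<in>?U. left B (sym_diff B A))"
    by (rule sum.swap)
  also have "\<dots> = (\<Sum>B\<in>?U. \<Sum>D\<in>?U. left B D)"
    by (intro sum.cong refl shift)
  also have "\<dots> = (\<Sum>B\<in>?U. \<Sum>D\<in>?U. right B D)"
    by (intro sum.cong refl left_eq_right)
  also have "\<dots> = clmul x (clmul y z) C"
    unfolding clmul_def right_def by (simp only: sum_distrib_left sum_distrib_right mult_ac)
  finally show "clmul (clmul x y) z C = clmul x (clmul y z) C" .
qed

lemma clmul_add_left: "clmul (x + y) z = clmul x z + clmul y z"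
  by (rule ext) (simp add: clmul_def sum.distrib algebra_simps)

lemma clmul_add_right: "clmul z (x + y) = clmul z x + clmul z y"
  by (rule ext) (simp add: clmul_def sum.distrib algebra_simps)

lemma clmul_scal_left: "clmul (scal c x) y = scal c (clmul x y)"
  unfolding clmul_def scal_def sum_distrib_left by (simp only: mult_ac)

lemma clmul_scal_right: "clmul x (scal c y) = scal c (clmul x y)"
  unfolding clmul_def scal_def sum_distrib_left by (simp only: mult_ac)

lemma clmul_zero_left [simp]: "clmul 0 x = 0"
  by (rule ext) (simp add: clmul_def)

lemma clmul_zero_right [simp]: "clmul x 0 = 0"
  by (rule ext) (simp add: clmul_def)

lemma clmul_sum_left: "clmul (\<Sum>k\<in>K. x k) y = (\<Sum>k\<in>K. clmul (x k) y)"
  by (induction K rule: infinite_finite_induct)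
    (simp_all add: clmul_add_left del: plus_fun_apply zero_fun_apply)

lemma clmul_sum_right: "clmul x (\<Sum>k\<in>K. y k) = (\<Sum>k\<in>K. clmul x (y k))"
  by (induction K rule: infinite_finite_induct)
    (simp_all add: clmul_add_right del: plus_fun_apply zero_fun_apply)

lemma sum_fun_apply: "(\<Sum>k\<in>K. f k) x = (\<Sum>k\<in>K. f k x)"
  by (induction K rule: infinite_finite_induct) simp_all

lemma scal_scal [simp]: "scal c (scal d x) = scal (c * d) x"
  by (simp add: scal_def mult.assoc)

lemma scal_one [simp]: "scal 1 x = x"
  by (simp add: scal_def)

lemma scal_add_right: "scal c (x + y) = scal c x + scal c y"
  by (rule ext) (simp add: scal_def algebra_simps)

lemma blade_clmul_apply:
  assumes "A \<subseteq> {1..15}"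
  shows "clmul (blade A) y C = csign A (sym_diff A C) * y (sym_diff A C)"
proof -
  have "clmul (blade A) y C
      = (\<Sum>B\<in>Pow {1..15}. if B = A then csign A (sym_diff A C) * y (sym_diff A C) else 0)"
    unfolding clmul_def blade_def by (intro sum.cong) auto
  then show ?thesis using assms by simp
qed

lemma blade_clmul_blade:
  assumes "A \<subseteq> {1..15}"
  shows "clmul (blade A) (blade B) = scal (csign A B) (blade (sym_diff A B))"
proof
  fix C
  have "sym_diff A C = B \<longleftrightarrow> C = sym_diff A B" by blast
  then show "clmul (blade A) (blade B) C = scal (csign A B) (blade (sym_diff A B)) C"
    unfolding blade_clmul_apply[OF assms] scal_def
    by (cases "sym_diff A C = B") (simp_all add: blade_def)
qed

lemma clmul_clone_left [simp]: "clmul clone x = x"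
  unfolding clone_def by (rule ext) (simp add: blade_clmul_apply)

lemma clmul_clone_right [simp]:
  assumes "x \<in> Cl15"
  shows "clmul x clone = x"
proof
  fix C
  have "clmul x clone C = (\<Sum>A\<in>Pow {1..15}. if A = C then x C else 0)"
    unfolding clmul_def clone_def blade_def by (intro sum.cong) auto
  then show "clmul x clone C = x C" using Cl15_zero_outside[OF assms] by simp
qed

subsection \<open>Units and conjugation of blades\<close>

definition Cl15_units :: "mv set" where
  "Cl15_units = {x \<in> Cl15. \<exists>y\<in>Cl15. clmul x y = clone \<and> clmul y x = clone}"

lemma Cl15_unitsI:
  "x \<in> Cl15 \<Longrightarrow> y \<in> Cl15 \<Longrightarrow> clmul x y = clone \<Longrightarrow> clmul y x = clone \<Longrightarrow> x \<in> Cl15_units"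
  unfolding Cl15_units_def by blast

lemma Cl15_units_subset: "Cl15_units \<subseteq> Cl15"
  unfolding Cl15_units_def by blast

lemma clone_in_Cl15_units: "clone \<in> Cl15_units"
  by (rule Cl15_unitsI[of _ clone]) (simp_all add: clone_in_Cl15)

lemma clmul_in_Cl15_units:
  assumes "x \<in> Cl15_units" "y \<in> Cl15_units"
  shows "clmul x y \<in> Cl15_units"
proof -
  obtain x' y' where in_Cl15: "x \<in> Cl15" "x' \<in> Cl15" "y \<in> Cl15" "y' \<in> Cl15"
    and inverse: "clmul x x' = clone" "clmul x' x = clone" "clmul y y' = clone" "clmul y' y = clone"
    using assms unfolding Cl15_units_def by blast
  have "clmul (clmul x y) (clmul y' x') = clmul x (clmul (clmul y y') x')"
    using in_Cl15 by (simp add: clmul_assoc clmul_in_Cl15)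
  moreover have "clmul (clmul y' x') (clmul x y) = clmul y' (clmul (clmul x' x) y)"
    using in_Cl15 by (simp add: clmul_assoc clmul_in_Cl15)
  ultimately show ?thesis
    using in_Cl15 inverse by (intro Cl15_unitsI[of _ "clmul y' x'"]) (simp_all add: clmul_in_Cl15)
qed

lemma scal_in_Cl15_units:
  assumes "x \<in> Cl15_units" "c \<noteq> 0"
  shows "scal c x \<in> Cl15_units"
proof -
  obtain y where "x \<in> Cl15" "y \<in> Cl15" "clmul x y = clone" "clmul y x = clone"
    using assms(1) unfolding Cl15_units_def by blast
  then show ?thesis
    using assms(2) by (intro Cl15_unitsI[of _ "scal (1 / c) y"])
      (simp_all add: scal_in_Cl15 clmul_scal_left clmul_scal_right)
qed

text \<open>For a unit \<open>x\<close> this says \<open>x e\<^sub>T x\<inverse> = \<plusminus> e\<^sub>T\<^sub>'\<close>; without the inverse the relation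
  composes along products.\<close>

definition carries_blade :: "mv \<Rightarrow> nat set \<Rightarrow> nat set \<Rightarrow> bool" where
  "carries_blade x T T' \<longleftrightarrow> (\<exists>c\<in>{1, -1}. clmul x (blade T) = scal c (clmul (blade T') x))"

lemma carries_bladeI:
  "c \<in> {1, -1} \<Longrightarrow> clmul x (blade T) = scal c (clmul (blade T') x) \<Longrightarrow> carries_blade x T T'"
  unfolding carries_blade_def by blast

lemma carries_blade_clone: "T \<subseteq> {1..15} \<Longrightarrow> carries_blade clone T T"
  by (rule carries_bladeI[of 1]) (simp_all add: blade_in_Cl15)

lemma carries_blade_clmul:
  assumes "carries_blade y T T'" "carries_blade x T' T''"
    and "y \<in> Cl15" "T \<subseteq> {1..15}" "T' \<subseteq> {1..15}"
  shows "carries_blade (clmul x y) T T''"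
proof -
  obtain c d where signs: "c \<in> {1, -1}" "d \<in> {1, -1}"
    and past_y: "clmul y (blade T) = scal c (clmul (blade T') y)"
    and past_x: "clmul x (blade T') = scal d (clmul (blade T'') x)"
    using assms(1,2) unfolding carries_blade_def by blast
  have "clmul (clmul x y) (blade T) = scal c (clmul (clmul x (blade T')) y)"
    using assms(3-5) by (simp add: clmul_assoc blade_in_Cl15 past_y clmul_scal_right)
  also have "\<dots> = scal (c * d) (clmul (blade T'') (clmul x y))"
    using assms(3) by (simp add: past_x clmul_scal_left clmul_assoc)
  finally show ?thesis
    using signs by (intro carries_bladeI[of "c * d"]) auto
qed

lemma carries_blade_scal: "carries_blade x T T' \<Longrightarrow> carries_blade (scal c x) T T'"
  unfolding carries_blade_def by (auto simp: clmul_scal_left clmul_scal_right)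

lemma conj_sum_blades:
  assumes bij: "bij_betw f \<F> \<G>" and \<G>: "\<G> \<subseteq> Pow {1..15}"
    and carries: "\<forall>T\<in>\<F>. carries_blade x T (f T)"
    and inverse: "y \<in> Cl15" "clmul x y = clone"
  obtains \<eta> where "\<forall>T\<in>\<G>. \<eta> T \<in> {1, -1}"
    "clmul (clmul x (\<Sum>T\<in>\<F>. blade T)) y = (\<Sum>T\<in>\<G>. scal (\<eta> T) (blade T))"
proof -
  obtain c where sign: "\<And>T. T \<in> \<F> \<Longrightarrow> c T \<in> {1, -1}"
    and past_x: "\<And>T. T \<in> \<F> \<Longrightarrow> clmul x (blade T) = scal (c T) (clmul (blade (f T)) x)"
    using carries unfolding carries_blade_def by metis
  define \<eta> where "\<eta> = c \<circ> the_inv_into \<F> f"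
  have \<eta>_image: "\<eta> (f T) = c T" if "T \<in> \<F>" for T
    using that bij by (simp add: \<eta>_def bij_betw_def the_inv_into_f_f)
  have "clmul (clmul x (blade T)) y = scal (\<eta> (f T)) (blade (f T))" if "T \<in> \<F>" for T
  proof -
    have "blade (f T) \<in> Cl15" using bij_betwE[OF bij] that \<G> by (intro blade_in_Cl15) blast
    then show ?thesis by (simp add: past_x \<eta>_image that clmul_scal_left clmul_assoc inverse)
  qed
  then have "clmul (clmul x (\<Sum>T\<in>\<F>. blade T)) y = (\<Sum>T\<in>\<F>. scal (\<eta> (f T)) (blade (f T)))"
    by (simp add: clmul_sum_left clmul_sum_right)
  also have "\<dots> = (\<Sum>T\<in>\<G>. scal (\<eta> T) (blade T))"
    using bij by (rule sum.reindex_bij_betw)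
  finally have conjugate: "clmul (clmul x (\<Sum>T\<in>\<F>. blade T)) y = (\<Sum>T\<in>\<G>. scal (\<eta> T) (blade T))" .
  have "\<eta> (f T) \<in> {1, -1}" if "T \<in> \<F>" for T
    unfolding \<eta>_image[OF that] using that by (rule sign)
  then have "\<forall>T\<in>\<G>. \<eta> T \<in> {1, -1}"
    unfolding bij_betw_imp_surj_on[OF bij, symmetric] by blast
  then show thesis using conjugate by (rule that)
qed

subsection \<open>A single plane\<close>

lemma rot1_eq: "rot1 a b \<epsilon> = clone + scal \<epsilon> (blade {a, b})"
  by (auto simp: rot1_def clone_def blade_def scal_def)

lemma rot1_in_Cl15: "{a, b} \<subseteq> {1..15} \<Longrightarrow> rot1 a b \<epsilon> \<in> Cl15"
  by (auto simp: rot1_def Cl15_def)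

lemma blade_doubleton_squared:
  assumes "a \<noteq> b" "{a, b} \<subseteq> {1..15}"
  shows "clmul (blade {a, b}) (blade {a, b}) = scal (-1) clone"
  using assms by (simp add: blade_clmul_blade csign_doubleton_self clone_def)

lemma rot1_clmul_rot1_uminus:
  assumes "a \<noteq> b" "{a, b} \<subseteq> {1..15}"
  shows "clmul (rot1 a b \<epsilon>) (rot1 a b (- \<epsilon>)) = scal (1 + \<epsilon>\<^sup>2) clone"
proof -
  have "clmul (rot1 a b \<epsilon>) (rot1 a b (- \<epsilon>))
      = clone + scal (- \<epsilon>) (blade {a, b}) + (scal \<epsilon> (blade {a, b}) + scal (\<epsilon>\<^sup>2) clone)"
    unfolding rot1_eq clmul_add_left clmul_add_right using assms
    by (simp add: clmul_scal_left clmul_scal_right blade_doubleton_squared blade_in_Cl15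
        power2_eq_square)
  then show ?thesis by (auto simp: scal_def algebra_simps)
qed

lemma rot1_in_Cl15_units:
  assumes "a \<noteq> b" "{a, b} \<subseteq> {1..15}"
  shows "rot1 a b \<epsilon> \<in> Cl15_units"
proof -
  have "1 + \<epsilon>\<^sup>2 \<noteq> 0" using zero_le_power2[of \<epsilon>] by linarith
  then show ?thesis
    using rot1_clmul_rot1_uminus[OF assms, of \<epsilon>] rot1_clmul_rot1_uminus[OF assms, of "- \<epsilon>"]
    by (intro Cl15_unitsI[of _ "scal (1 / (1 + \<epsilon>\<^sup>2)) (rot1 a b (- \<epsilon>))"])
      (simp_all only: rot1_in_Cl15[OF assms(2)] scal_in_Cl15 clmul_scal_left clmul_scal_right,
        simp_all)
qed

lemma rot1_clmul_blade:
  assumes "a \<noteq> b" "{a, b} \<subseteq> {1..15}" "T \<subseteq> {1..15}"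
  shows "clmul (rot1 a b \<epsilon>) (blade T)
    = clmul (blade T) (rot1 a b (if a \<in> T \<longleftrightarrow> b \<in> T then \<epsilon> else - \<epsilon>))"
proof -
  have "finite T" using assms by (auto intro: finite_subset)
  moreover have "sym_diff T {a, b} = sym_diff {a, b} T" by blast
  ultimately have "clmul (blade {a, b}) (blade T)
      = scal (if a \<in> T \<longleftrightarrow> b \<in> T then 1 else -1) (clmul (blade T) (blade {a, b}))"
    using assms by (simp add: blade_clmul_blade csign_doubleton_commute)
  then show ?thesis
    unfolding rot1_eq clmul_add_left clmul_add_right
    using assms by (simp add: clmul_scal_left clmul_scal_right blade_in_Cl15)
qed

lemma blade_clmul_rot1:
  assumes "a \<noteq> b" "{a, b} \<subseteq> {1..15}" "\<epsilon> \<in> {1, -1}"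
  shows "clmul (blade {a, b}) (rot1 a b \<epsilon>) = scal (- \<epsilon>) (rot1 a b (- \<epsilon>))"
  using assms unfolding rot1_eq clmul_add_right scal_add_right
  by (auto simp: clmul_scal_right blade_doubleton_squared blade_in_Cl15 add.commute)

lemma transpose_image_split:
  assumes "a \<in> T \<longleftrightarrow> b \<notin> T"
  shows "transpose a b ` T = sym_diff T {a, b}"
  using assms by (auto simp: in_transpose_image_iff Transposition.transpose_def split: if_splits)

lemma rot1_carries_blade:
  assumes "a \<noteq> b" "{a, b} \<subseteq> {1..15}" "\<epsilon> \<in> {1, -1}" "T \<subseteq> {1..15}"
  shows "carries_blade (rot1 a b \<epsilon>) T (transpose a b ` T)"
proof (cases "a \<in> T \<longleftrightarrow> b \<in> T")
  case True
  then show ?thesis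
    using assms by (intro carries_bladeI[of 1]) (simp_all add: rot1_clmul_blade)
next
  case False
  let ?T' = "sym_diff T {a, b}" and ?\<sigma> = "csign T {a, b}"
  have "clmul (blade ?T') (rot1 a b \<epsilon>)
      = scal ?\<sigma> (clmul (clmul (blade T) (blade {a, b})) (rot1 a b \<epsilon>))"
    using assms(4) by (simp add: blade_clmul_blade clmul_scal_left)
  also have "\<dots> = scal (- (?\<sigma> * \<epsilon>)) (clmul (rot1 a b \<epsilon>) (blade T))"
    using False assms
    by (simp add: clmul_assoc rot1_in_Cl15 blade_clmul_rot1 clmul_scal_right rot1_clmul_blade)
  finally have "clmul (rot1 a b \<epsilon>) (blade T) = scal (- (?\<sigma> * \<epsilon>)) (clmul (blade ?T') (rot1 a b \<epsilon>))"
    using assms(3) csign_in_signs[of T "{a, b}"] by auto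
  then show ?thesis
    using False assms(3) csign_in_signs[of T "{a, b}"]
    by (intro carries_bladeI[of "- (?\<sigma> * \<epsilon>)"]) (auto simp: transpose_image_split)
qed

subsection \<open>Products over several planes\<close>

fun endpoints :: "('a \<times> 'a) list \<Rightarrow> 'a list" where
  "endpoints [] = []"
| "endpoints ((a, b) # ps) = a # b # endpoints ps"

lemma distinct_endpoints_imp_neq: "distinct (endpoints ps) \<Longrightarrow> \<forall>(a, b)\<in>set ps. a \<noteq> b"
  by (induction ps rule: endpoints.induct) auto

lemma set_endpoints: "set (endpoints ps) = (\<Union>(a, b)\<in>set ps. {a, b})"
  by (induction ps rule: endpoints.induct) auto

fun transposes :: "('a \<times> 'a) list \<Rightarrow> 'a \<Rightarrow> 'a" where
  "transposes [] = id"
| "transposes ((a, b) # ps) = transpose a b \<circ> transposes ps"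

lemma transposes_outside: "x \<notin> set (endpoints ps) \<Longrightarrow> transposes ps x = x"
  by (induction ps rule: transposes.induct) auto

lemma transposes_endpoints:
  assumes "distinct (endpoints ps)" "(a, b) \<in> set ps"
  shows "transposes ps a = b \<and> transposes ps b = a"
  using assms
proof (induction ps rule: transposes.induct)
  case (2 c d ps)
  show ?case
  proof (cases "(a, b) = (c, d)")
    case True
    then show ?thesis using "2.prems"(1) by (simp add: transposes_outside)
  next
    case False
    then have "(a, b) \<in> set ps" using "2.prems"(2) by auto
    moreover from this have "{a, b} \<subseteq> set (endpoints ps)" by (auto simp: set_endpoints)
    ultimately show ?thesis using 2 by (auto intro!: transpose_apply_other)
  qed
qed simp

lemma transposes_image_subset:
  "set (endpoints ps) \<subseteq> S \<Longrightarrow> T \<subseteq> S \<Longrightarrow> transposes ps ` T \<subseteq> S"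
proof (induction ps rule: transposes.induct)
  case (2 a b ps)
  then have "transposes ps ` T \<subseteq> S" "a \<in> S" "b \<in> S" by simp_all
  then show ?case by (auto simp: Transposition.transpose_def)
qed simp

fun rot_prod :: "(nat \<times> nat) list \<Rightarrow> real list \<Rightarrow> mv" where
  "rot_prod ((a, b) # ps) (\<epsilon> # \<epsilon>s) = clmul (rot1 a b \<epsilon>) (rot_prod ps \<epsilon>s)"
| "rot_prod _ _ = clone"

lemma rot_prod_in_Cl15_units:
  assumes "\<forall>(a, b)\<in>set ps. a \<noteq> b" "set (endpoints ps) \<subseteq> {1..15}"
  shows "rot_prod ps \<epsilon>s \<in> Cl15_units"
  using assms by (induction ps \<epsilon>s rule: rot_prod.induct)
    (simp_all add: clmul_in_Cl15_units rot1_in_Cl15_units clone_in_Cl15_units)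

lemma rot_prod_carries_blade:
  assumes "\<forall>(a, b)\<in>set ps. a \<noteq> b" "set (endpoints ps) \<subseteq> {1..15}"
    and "length ps = length \<epsilon>s" "set \<epsilon>s \<subseteq> {1, -1}" "T \<subseteq> {1..15}"
  shows "carries_blade (rot_prod ps \<epsilon>s) T (transposes ps ` T)"
  using assms
proof (induction ps \<epsilon>s rule: rot_prod.induct)
  case (1 a b ps \<epsilon> \<epsilon>s)
  let ?T' = "transposes ps ` T"
  have T': "?T' \<subseteq> {1..15}"
    using "1.prems" by (intro transposes_image_subset) simp_all
  then have "carries_blade (rot1 a b \<epsilon>) ?T' (transpose a b ` ?T')"
    using "1.prems" by (intro rot1_carries_blade) simp_all
  moreover have "carries_blade (rot_prod ps \<epsilon>s) T ?T'"
    using 1 by simp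
  moreover have "rot_prod ps \<epsilon>s \<in> Cl15"
    using "1.prems"(1,2) rot_prod_in_Cl15_units[of ps \<epsilon>s] Cl15_units_subset by auto
  ultimately have "carries_blade (clmul (rot1 a b \<epsilon>) (rot_prod ps \<epsilon>s)) T (transpose a b ` ?T')"
    using carries_blade_clmul T' "1.prems"(5) by blast
  then show ?case by (simp add: image_comp)
qed (simp_all add: carries_blade_clone)

lemma rot1_clmul_apply:
  assumes "{a, b} \<subseteq> {1..15}"
  shows "clmul (rot1 a b \<epsilon>) x C
    = x C + \<epsilon> * (csign {a, b} (sym_diff {a, b} C) * x (sym_diff {a, b} C))"
proof -
  have "clmul (rot1 a b \<epsilon>) x = x + scal \<epsilon> (clmul (blade {a, b}) x)"
    by (simp only: rot1_eq clmul_add_left clmul_scal_left clmul_clone_left)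
  then show ?thesis by (simp only: plus_fun_apply scal_def blade_clmul_apply[OF assms])
qed

lemma rot_prod_support:
  assumes "distinct (endpoints ps)" "set (endpoints ps) \<subseteq> {1..15}" "rot_prod ps \<epsilon>s C \<noteq> 0"
  shows "C \<subseteq> set (endpoints ps) \<and> (\<forall>(a, b)\<in>set ps. a \<in> C \<longleftrightarrow> b \<in> C)"
  using assms
proof (induction ps \<epsilon>s arbitrary: C rule: rot_prod.induct)
  case (1 a b ps \<epsilon> \<epsilon>s)
  let ?D = "sym_diff {a, b} C"
  have fresh: "a \<notin> set (endpoints ps)" "b \<notin> set (endpoints ps)" using "1.prems"(1) by simp_all
  have support: "D \<subseteq> set (endpoints ps)" "\<And>c d. (c, d) \<in> set ps \<Longrightarrow> c \<in> D \<longleftrightarrow> d \<in> D"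
    if "rot_prod ps \<epsilon>s D \<noteq> 0" for D
    using "1.IH"[OF _ _ that] "1.prems"(1,2) by auto
  have "rot_prod ps \<epsilon>s C \<noteq> 0 \<or> rot_prod ps \<epsilon>s ?D \<noteq> 0"
    using "1.prems"(2,3) by (auto simp: rot1_clmul_apply)
  then show ?case
  proof
    assume "rot_prod ps \<epsilon>s C \<noteq> 0"
    then show ?thesis using support[of C] fresh by auto
  next
    assume nonzero: "rot_prod ps \<epsilon>s ?D \<noteq> 0"
    have "c \<in> C \<longleftrightarrow> d \<in> C" if "(c, d) \<in> set ps" for c d
    proof -
      have "{c, d} \<subseteq> set (endpoints ps)" using that by (auto simp: set_endpoints)
      then have "c \<in> C \<longleftrightarrow> c \<in> ?D" "d \<in> C \<longleftrightarrow> d \<in> ?D" using fresh by auto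
      then show ?thesis using support(2)[OF nonzero that] by blast
    qed
    then show ?thesis using support(1)[OF nonzero] fresh by auto
  qed
qed (simp_all add: clone_def blade_def split: if_splits)

lemma rot_prod_empty:
  assumes "distinct (endpoints ps)" "set (endpoints ps) \<subseteq> {1..15}"
  shows "rot_prod ps \<epsilon>s {} = 1"
  using assms
proof (induction ps \<epsilon>s rule: rot_prod.induct)
  case (1 a b ps \<epsilon> \<epsilon>s)
  then have "rot_prod ps \<epsilon>s {a, b} = 0" using rot_prod_support[of ps \<epsilon>s "{a, b}"] by auto
  then show ?case using 1 by (simp add: rot1_clmul_apply)
qed (simp_all add: clone_def blade_def)

lemma rot_prod_coeff:
  assumes "distinct (endpoints ps)" "set (endpoints ps) \<subseteq> {1..15}"
    and "((a, b), \<epsilon>) \<in> set (zip ps \<epsilon>s)"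
  shows "rot_prod ps \<epsilon>s {a, b} = \<epsilon>"
  using assms
proof (induction ps \<epsilon>s rule: rot_prod.induct)
  case (1 c d ps \<delta> \<epsilon>s)
  have fresh: "c \<notin> set (endpoints ps)" "d \<notin> set (endpoints ps)" using "1.prems"(1) by simp_all
  have outside: "rot_prod ps \<epsilon>s C = 0" if "c \<in> C" for C
    using that fresh "1.prems"(1,2) rot_prod_support[of ps \<epsilon>s C] by auto
  show ?case
  proof (cases "((a, b), \<epsilon>) = ((c, d), \<delta>)")
    case True
    then show ?thesis using "1.prems"(1,2) outside[of "{c, d}"]
      by (simp add: rot1_clmul_apply rot_prod_empty)
  next
    case False
    then have later: "((a, b), \<epsilon>) \<in> set (zip ps \<epsilon>s)" using "1.prems"(3) by auto
    then have "{a, b} \<subseteq> set (endpoints ps)"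
      by (auto simp: set_endpoints dest!: set_zip_leftD)
    then have "c \<in> sym_diff {c, d} {a, b}" using fresh by auto
    then show ?thesis
      using 1 later outside[of "sym_diff {c, d} {a, b}"] by (simp add: rot1_clmul_apply)
  qed
qed simp_all

lemma rot_prod_doubleton_support:
  assumes disjoint: "distinct (endpoints ps)" "set (endpoints ps) \<subseteq> {1..15}"
    and signs: "length ps = length \<epsilon>s" "0 \<notin> set \<epsilon>s"
  shows "{C. card C = 2 \<and> rot_prod ps \<epsilon>s C \<noteq> 0} = (\<lambda>(a, b). {a, b}) ` set ps"
proof (intro equalityI subsetI)
  fix C assume "C \<in> {C. card C = 2 \<and> rot_prod ps \<epsilon>s C \<noteq> 0}"
  then have card: "card C = 2" and "rot_prod ps \<epsilon>s C \<noteq> 0" by simp_all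
  then have support: "C \<subseteq> set (endpoints ps)" "\<forall>(a, b)\<in>set ps. a \<in> C \<longleftrightarrow> b \<in> C"
    using rot_prod_support[OF disjoint] by simp_all
  have "C \<noteq> {}" "finite C" using card by (auto intro: card_ge_0_finite)
  then obtain a b where pair: "(a, b) \<in> set ps" "a \<in> C \<or> b \<in> C"
    using support(1) unfolding set_endpoints by blast
  then have "{a, b} \<subseteq> C" using support(2) by auto
  moreover have "card {a, b} = card C"
    using card pair(1) distinct_endpoints_imp_neq[OF disjoint(1)] by auto
  ultimately have "C = {a, b}"
    using \<open>finite C\<close> card_subset_eq[of C "{a, b}"] by simp
  with pair(1) show "C \<in> (\<lambda>(a, b). {a, b}) ` set ps" by (simp add: rev_image_eqI)
next
  fix C assume "C \<in> (\<lambda>(a, b). {a, b}) ` set ps"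
  then obtain a b where pair: "(a, b) \<in> set ps" "C = {a, b}" by auto
  then obtain \<epsilon> where "((a, b), \<epsilon>) \<in> set (zip ps \<epsilon>s)"
    using signs(1) by (metis in_set_impl_in_set_zip1)
  moreover from this have "\<epsilon> \<noteq> 0" using signs(2) by (metis set_zip_rightD)
  ultimately show "C \<in> {C. card C = 2 \<and> rot_prod ps \<epsilon>s C \<noteq> 0}"
    using rot_prod_coeff[OF disjoint] pair distinct_endpoints_imp_neq[OF disjoint(1)] by auto
qed

subsection \<open>Hyperplanes of the binary projective space\<close>

definition gf2_dot :: "nat \<Rightarrow> nat \<Rightarrow> bool" where
  "gf2_dot u x \<longleftrightarrow> odd (\<Sum>k<4. of_bool (bit u k \<and> bit x k) :: nat)"

definition hyperplane :: "nat \<Rightarrow> nat set" where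
  "hyperplane u = {x \<in> {1..15}. \<not> gf2_dot u x}"

definition affine_hyperplane :: "nat \<Rightarrow> nat set" where
  "affine_hyperplane u = {x \<in> {1..15}. gf2_dot u x}"

definition affine_hyperplanes :: "nat set set" where
  "affine_hyperplanes = affine_hyperplane ` {1..15}"

definition transvection :: "nat \<Rightarrow> nat \<Rightarrow> nat \<Rightarrow> nat" where
  "transvection u d x = (if gf2_dot u x then xor x d else x)"

lemma gf2_dot_commute: "gf2_dot u x = gf2_dot x u"
  by (simp add: gf2_dot_def conj_commute)

lemma gf2_dot_xor_right: "gf2_dot u (xor x y) \<longleftrightarrow> gf2_dot u x \<noteq> gf2_dot u y"
proof -
  have "(\<Sum>k<4. of_bool (bit u k \<and> bit x k)) + (\<Sum>k<4. of_bool (bit u k \<and> bit y k))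
    = (\<Sum>k<4. of_bool (bit u k \<and> bit (xor x y) k))
      + 2 * (\<Sum>k<4. of_bool (bit u k \<and> bit x k \<and> bit y k) :: nat)"
    unfolding sum_distrib_left sum.distrib[symmetric]
    by (intro sum.cong) (auto simp: bit_xor_iff)
  then show ?thesis unfolding gf2_dot_def by presburger
qed

lemma gf2_dot_xor_left: "gf2_dot (xor u v) x \<longleftrightarrow> gf2_dot u x \<noteq> gf2_dot v x"
  using gf2_dot_xor_right by (simp add: gf2_dot_commute[of _ x])

lemma xor_eq_0_iff: "xor x y = 0 \<longleftrightarrow> x = y"
  for x y :: "'a::semiring_bit_operations"
  by (metis xor.assoc xor.left_neutral xor.right_neutral xor_self_eq)

lemma xor_in_range:
  assumes "x \<in> {1..15}" "d \<le> 15" "x \<noteq> d"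
  shows "xor x d \<in> {1..15::nat}"
proof -
  have "take_bit 4 (xor x d) = xor x d"
    using assms by (simp add: take_bit_nat_eq_self)
  then have "xor x d < 2 ^ 4" unfolding take_bit_nat_eq_self_iff .
  moreover have "xor x d \<noteq> 0" using assms(3) by (simp add: xor_eq_0_iff)
  ultimately show ?thesis by simp
qed

lemma transvection_involution: "\<not> gf2_dot u d \<Longrightarrow> transvection u d (transvection u d x) = x"
  by (simp add: transvection_def gf2_dot_xor_right xor.assoc)

lemma transvection_in_range_iff:
  assumes "\<not> gf2_dot u d" "d \<le> 15"
  shows "transvection u d x \<in> {1..15} \<longleftrightarrow> x \<in> {1..15}"
proof -
  have "transvection u d y \<in> {1..15}" if "y \<in> {1..15}" for y
    using that assms xor_in_range[of y d] by (auto simp: transvection_def)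
  then show ?thesis using transvection_involution[OF assms(1)] by metis
qed

lemma gf2_dot_transvection:
  "gf2_dot v (transvection u d x) \<longleftrightarrow> gf2_dot (if gf2_dot v d then xor u v else v) x"
  by (auto simp: transvection_def gf2_dot_xor_right gf2_dot_xor_left)

lemma transvection_image_hyperplane:
  assumes "\<not> gf2_dot u d" "d \<le> 15"
  shows "transvection u d ` hyperplane v = hyperplane (if gf2_dot v d then xor u v else v)"
    (is "_ = hyperplane ?w")
proof -
  have "x \<in> transvection u d ` hyperplane v \<longleftrightarrow> transvection u d x \<in> hyperplane v" for x
    using transvection_involution[OF assms(1)] by (metis image_iff)
  also have "transvection u d x \<in> hyperplane v \<longleftrightarrow> x \<in> hyperplane ?w" for x
    using transvection_in_range_iff[OF assms]
    unfolding hyperplane_def mem_Collect_eq gf2_dot_transvection by blast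
  finally show ?thesis by blast
qed

lemma bij_betw_transvection_hyperplanes:
  assumes "u \<in> {1..15}" "\<not> gf2_dot u d" "d \<le> 15"
  shows "bij_betw (image (transvection u d)) (hyperplane ` {1..15}) (hyperplane ` {1..15})"
proof -
  have "(if gf2_dot v d then xor u v else v) \<in> {1..15}" if "v \<in> {1..15}" for v
    using that assms xor_in_range[of u v] by auto
  then have maps: "transvection u d ` T \<in> hyperplane ` {1..15}" if "T \<in> hyperplane ` {1..15}" for T
    using that assms by (auto simp: transvection_image_hyperplane)
  have "transvection u d ` transvection u d ` T = T" for T
    using assms by (simp add: image_image transvection_involution)
  with maps show ?thesis by (intro bij_betw_byWitness[of _ "image (transvection u d)"]) auto
qed

lemma transposes_eq_transvection:
  assumes "distinct (endpoints ps)" "set (endpoints ps) = affine_hyperplane u"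
    and "\<forall>(a, b)\<in>set ps. xor a b = d" "x \<in> {1..15}"
  shows "transposes ps x = transvection u d x"
proof (cases "gf2_dot u x")
  case True
  then have "x \<in> set (endpoints ps)" using assms(2,4) by (simp add: affine_hyperplane_def)
  then obtain a b where pair: "(a, b) \<in> set ps" "x = a \<or> x = b"
    by (auto simp: set_endpoints)
  moreover have "xor a d = b" "xor b d = a"
  proof -
    have difference: "d = xor a b" "d = xor b a"
      using assms(3) pair(1) by (auto simp: xor.commute)
    show "xor a d = b" unfolding difference(1) by (simp flip: xor.assoc)
    show "xor b d = a" unfolding difference(2) by (simp flip: xor.assoc)
  qed
  ultimately show ?thesis
    using True transposes_endpoints[OF assms(1) pair(1)] by (auto simp: transvection_def)
next
  case False
  then show ?thesis
    using assms(2) by (simp add: transvection_def transposes_outside affine_hyperplane_def)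
qed

subsection \<open>The terms of Phi and of its dual\<close>

lemma set_PhiTerms: "set PhiTerms = hyperplane ` {1..15}"
  by code_simp

lemma PhiTerms_subset: "set PhiTerms \<subseteq> Pow {1..15}"
  unfolding set_PhiTerms hyperplane_def by blast

lemma length_PhiTerms: "length PhiTerms = 15"
  by (simp add: PhiTerms_def)

lemma distinct_PhiTerms: "distinct PhiTerms"
  by code_simp

lemma sum_PhiTerms_nth: "(\<Sum>k<15. f (PhiTerms ! k)) = (\<Sum>T\<in>set PhiTerms. f T)"
  by (rule sum.reindex_bij_betw, rule bij_betw_nth)
    (simp_all add: distinct_PhiTerms length_PhiTerms)

lemma Phi_eq_sum_blades: "Phi = (\<Sum>T\<in>set PhiTerms. blade T)"
  unfolding Phi_def by (rule ext) (simp only: sum_fun_apply sum_PhiTerms_nth[of "\<lambda>T. blade T _"])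

lemma Phi_nonzero_iff: "Phi B \<noteq> 0 \<longleftrightarrow> B \<in> set PhiTerms"
  by (simp add: Phi_eq_sum_blades sum_fun_apply blade_def)

lemma affine_hyperplane_eq_Diff: "affine_hyperplane u = {1..15} - hyperplane u"
  unfolding affine_hyperplane_def hyperplane_def by blast

lemma PhiStar_nonzero_iff: "PhiStar A \<noteq> 0 \<longleftrightarrow> A \<in> affine_hyperplanes"
proof -
  define B where "B = sym_diff {1..15} A"
  have "PhiStar A = - (csign {1..15} B * Phi B)"
    unfolding PhiStar_def scal_def by (simp add: blade_clmul_apply B_def)
  then have "PhiStar A \<noteq> 0 \<longleftrightarrow> B \<in> hyperplane ` {1..15}"
    unfolding set_PhiTerms[symmetric] Phi_nonzero_iff[symmetric]
    using csign_in_signs[of "{1..15}" B] by auto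
  also have "B = hyperplane u \<longleftrightarrow> A = affine_hyperplane u" for u
  proof -
    have "hyperplane u \<subseteq> {1..15}" unfolding hyperplane_def by blast
    then show ?thesis unfolding B_def affine_hyperplane_eq_Diff by blast
  qed
  then have "B \<in> hyperplane ` {1..15} \<longleftrightarrow> A \<in> affine_hyperplanes"
    by (simp add: affine_hyperplanes_def image_iff)
  finally show ?thesis .
qed

lemma card_affine_hyperplanes: "card affine_hyperplanes = 15"
  by code_simp

lemma card_affine_hyperplane_eq_8: "\<forall>A\<in>affine_hyperplanes. card A = 8"
  by code_simp

lemma affine_hyperplanes_subset: "affine_hyperplanes \<subseteq> Pow {1..15}"
  unfolding affine_hyperplanes_def affine_hyperplane_def by blast

lemma
  assumes "A \<in> affine_hyperplanes"
  shows set_sorted_affine_hyperplane: "set (sorted_list_of_set A) = A"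
    and length_sorted_affine_hyperplane: "length (sorted_list_of_set A) = 8"
proof -
  have "A \<subseteq> {1..15}" using assms affine_hyperplanes_subset by blast
  then show "set (sorted_list_of_set A) = A" by (auto dest: finite_subset)
  show "length (sorted_list_of_set A) = 8" using assms card_affine_hyperplane_eq_8 by simp
qed

subsection \<open>The seven pairings\<close>

definition plane_pairs :: "nat list \<Rightarrow> (nat \<times> nat) list \<Rightarrow> (nat \<times> nat) list" where
  "plane_pairs m P = map (map_prod ((!) m) ((!) m)) P"

lemma planes_eq_plane_pairs: "planes m P = (\<lambda>(a, b). {a, b}) ` set (plane_pairs m P)"
  by (simp add: planes_def plane_pairs_def image_image case_prod_beta)

lemma length_plane_pairs [simp]: "length (plane_pairs m P) = length P"
  by (simp add: plane_pairs_def)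

lemma endpoints_plane_pairs: "endpoints (plane_pairs m P) = map ((!) m) (endpoints P)"
  unfolding plane_pairs_def by (induction P rule: endpoints.induct) simp_all

lemma card_pairings: "card (set pairings) = 7"
  by (simp add: pairings_def)

lemma
  assumes "P \<in> set pairings"
  shows length_pairing: "length P = 4"
    and distinct_endpoints_pairing: "distinct (endpoints P)"
    and set_endpoints_pairing: "set (endpoints P) = {..<8}"
  using assms by (auto simp: pairings_def)

lemma
  assumes "P \<in> set pairings" "distinct m" "length m = 8"
  shows distinct_endpoints_plane_pairs: "distinct (endpoints (plane_pairs m P))"
    and set_endpoints_plane_pairs: "set (endpoints (plane_pairs m P)) = set m"
proof -
  have "inj_on ((!) m) {..<8}" using assms by (intro inj_on_nth) auto
  moreover have "(!) m ` {..<8} = set m"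
    using assms nth_image[of 8 m] by (simp add: atLeast0LessThan)
  ultimately show "distinct (endpoints (plane_pairs m P))"
    and "set (endpoints (plane_pairs m P)) = set m"
    using distinct_endpoints_pairing[OF assms(1)] set_endpoints_pairing[OF assms(1)]
    by (simp_all add: endpoints_plane_pairs distinct_map)
qed

text \<open>The increasing enumeration of an affine hyperplane is affine in the bits of the position, and
  the seven pairings of positions are the seven nonzero translations of the three-bit vectors.\<close>

lemma pairing_is_translation:
  assumes "A \<in> affine_hyperplanes" "P \<in> set pairings"
  obtains d where "\<forall>(a, b)\<in>set (plane_pairs (sorted_list_of_set A) P). xor a b = d"
proof -
  have "\<forall>m\<in>sorted_list_of_set ` affine_hyperplanes. \<forall>P\<in>set pairings.
      card ((\<lambda>(i, j). xor (m ! i) (m ! j)) ` set P) = 1"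
    by code_simp
  then have "card ((\<lambda>(a, b). xor a b) ` set (plane_pairs (sorted_list_of_set A) P)) = 1"
    using assms by (simp add: plane_pairs_def image_image case_prod_beta)
  then obtain d where "(\<lambda>(a, b). xor a b) ` set (plane_pairs (sorted_list_of_set A) P) = {d}"
    by (auto simp: card_1_singleton_iff)
  then show thesis by (intro that[of d]) fastforce
qed

lemma transposes_pairing_eq_transvection:
  assumes "A \<in> affine_hyperplanes" "P \<in> set pairings"
  obtains u d where "u \<in> {1..15}" "\<not> gf2_dot u d" "d \<le> 15"
    "\<And>x. x \<in> {1..15} \<Longrightarrow> transposes (plane_pairs (sorted_list_of_set A) P) x = transvection u d x"
proof -
  let ?ps = "plane_pairs (sorted_list_of_set A) P"
  obtain u where u: "u \<in> {1..15}" "A = affine_hyperplane u"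
    using assms(1) unfolding affine_hyperplanes_def by blast
  obtain d where translation: "\<forall>(a, b)\<in>set ?ps. xor a b = d"
    using pairing_is_translation[OF assms] .
  have disjoint: "distinct (endpoints ?ps)" and endpoints: "set (endpoints ?ps) = A"
    using assms by (simp_all add: distinct_endpoints_plane_pairs set_endpoints_plane_pairs
        set_sorted_affine_hyperplane length_sorted_affine_hyperplane
        del: length_sorted_list_of_set set_sorted_list_of_set)
  obtain a b where "hd ?ps = (a, b)" by (rule prod.exhaust)
  moreover have "?ps \<noteq> []" using length_pairing[OF assms(2)] by (auto simp: plane_pairs_def)
  ultimately have pair: "(a, b) \<in> set ?ps" using hd_in_set[of ?ps] by simp
  then have "{a, b} \<subseteq> set (endpoints ?ps)" unfolding set_endpoints by blast
  then have "{a, b} \<subseteq> A" unfolding endpoints .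
  moreover have "a \<noteq> b" "xor a b = d"
    using pair distinct_endpoints_imp_neq[OF disjoint] translation by auto
  ultimately have direction: "\<not> gf2_dot u d" "d \<le> 15"
    using xor_in_range[of a b] by (auto simp: u(2) affine_hyperplane_def gf2_dot_xor_right)
  show thesis
    by (rule that[OF u(1) direction])
      (rule transposes_eq_transvection[OF disjoint trans[OF endpoints u(2)] translation])
qed

lemma inj_on_position_planes: "inj_on (planes [0..<8]) (set pairings)"
proof -
  have "\<forall>P\<in>set pairings. \<forall>Q\<in>set pairings. planes [0..<8] P = planes [0..<8] Q \<longrightarrow> P = Q"
    by code_simp
  then show ?thesis by (auto intro: inj_onI)
qed

lemma planes_eq_image_positions:
  assumes "P \<in> set pairings"
  shows "planes m P = image ((!) m) ` planes [0..<8] P"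
proof -
  have "i < 8 \<and> j < 8" if "(i, j) \<in> set P" for i j
    using that set_endpoints_pairing[OF assms] by (auto simp: set_endpoints)
  then show ?thesis
    unfolding planes_def image_image by (intro image_cong) auto
qed

lemma Union_planes:
  assumes "P \<in> set pairings" "distinct m" "length m = 8"
  shows "\<Union> (planes m P) = set m"
  unfolding set_endpoints_plane_pairs[OF assms, symmetric]
  by (simp add: planes_eq_plane_pairs set_endpoints case_prod_beta)

lemma inj_on_planes:
  assumes m: "distinct m" "length m = 8"
  shows "inj_on (planes m) (set pairings)"
proof (rule inj_onI)
  fix P Q assume P: "P \<in> set pairings" "Q \<in> set pairings" and "planes m P = planes m Q"
  then have "image ((!) m) ` planes [0..<8] P = image ((!) m) ` planes [0..<8] Q"
    by (simp add: planes_eq_image_positions[of _ m])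
  moreover have "inj_on (image ((!) m)) (Pow {..<8})"
    using m by (intro inj_on_image_Pow inj_on_nth) auto
  moreover have "planes [0..<8] R \<subseteq> Pow {..<8}" if "R \<in> set pairings" for R
    using Union_planes[OF that, of "[0..<8]"] by (auto simp: atLeast0LessThan)
  ultimately have "planes [0..<8] P = planes [0..<8] Q"
    using P inj_on_image_eq_iff by meson
  then show "P = Q" using inj_on_position_planes P by (simp add: inj_on_eq_iff)
qed

subsection \<open>The rotors\<close>

lemma card_sign_patterns: "card (set sign_patterns) = 4"
  by (simp add: sign_patterns_def)

lemma
  assumes "s \<in> set sign_patterns"
  shows length_sign_pattern: "length s = 4"
    and set_sign_pattern_subset: "set s \<subseteq> {1, -1}"
  using assms by (auto simp: sign_patterns_def)

lemma rotor_eq_rot_prod: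
  assumes "length P = 4" "length s = 4" "set (endpoints (plane_pairs m P)) \<subseteq> {1..15}"
  shows "rotor m P s = scal (1/4) (rot_prod (plane_pairs m P) s)"
proof -
  obtain p0 p1 p2 p3 where P_eq: "P = [p0, p1, p2, p3]"
    using assms(1) by (auto simp: numeral_eq_Suc length_Suc_conv)
  obtain s0 s1 s2 s3 where s_eq: "s = [s0, s1, s2, s3]"
    using assms(2) by (auto simp: numeral_eq_Suc length_Suc_conv)
  have "rot1 (m ! fst p) (m ! snd p) \<epsilon> \<in> Cl15" if "p \<in> set P" for p \<epsilon>
    using that assms(3) by (intro rot1_in_Cl15)
      (fastforce simp: plane_pairs_def set_endpoints case_prod_beta)
  then show ?thesis
    by (simp add: P_eq s_eq rotor_def plane_pairs_def map_prod_def case_prod_beta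
        clmul_assoc clmul_in_Cl15)
qed

context
  fixes m :: "nat list" and P :: "(nat \<times> nat) list"
  assumes m: "distinct m" "length m = 8" "set m \<subseteq> {1..15}" and P: "P \<in> set pairings"
begin

lemma disjoint_planes:
  "distinct (endpoints (plane_pairs m P))" "set (endpoints (plane_pairs m P)) \<subseteq> {1..15}"
  using distinct_endpoints_plane_pairs[OF P m(1,2)] set_endpoints_plane_pairs[OF P m(1,2)] m(3)
  by simp_all

lemma length_plane_pairs_eq_length_signs:
  "s \<in> set sign_patterns \<Longrightarrow> length (plane_pairs m P) = length s"
  using length_pairing[OF P] length_sign_pattern by simp

lemma rotor_pairing_eq_rot_prod:
  "s \<in> set sign_patterns \<Longrightarrow> rotor m P s = scal (1/4) (rot_prod (plane_pairs m P) s)"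
  using length_pairing[OF P] disjoint_planes(2) length_sign_pattern
  by (intro rotor_eq_rot_prod) simp_all

lemma rotor_in_Cl15_units: "s \<in> set sign_patterns \<Longrightarrow> rotor m P s \<in> Cl15_units"
  using disjoint_planes
  by (simp add: rotor_pairing_eq_rot_prod scal_in_Cl15_units rot_prod_in_Cl15_units
      distinct_endpoints_imp_neq)

lemma rotor_carries_blade:
  assumes "s \<in> set sign_patterns" "T \<subseteq> {1..15}"
  shows "carries_blade (rotor m P s) T (transposes (plane_pairs m P) ` T)"
  unfolding rotor_pairing_eq_rot_prod[OF assms(1)]
  using assms disjoint_planes set_sign_pattern_subset
  by (intro carries_blade_scal rot_prod_carries_blade distinct_endpoints_imp_neq
      length_plane_pairs_eq_length_signs)

lemma planes_eq_rotor_support: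
  assumes "s \<in> set sign_patterns"
  shows "planes m P = {C. card C = 2 \<and> rotor m P s C \<noteq> 0}"
proof -
  have "0 \<notin> set s" using set_sign_pattern_subset[OF assms] by auto
  then have "{C. card C = 2 \<and> rot_prod (plane_pairs m P) s C \<noteq> 0} = planes m P"
    unfolding planes_eq_plane_pairs using assms disjoint_planes
    by (intro rot_prod_doubleton_support length_plane_pairs_eq_length_signs)
  then show ?thesis
    by (simp add: rotor_pairing_eq_rot_prod[OF assms] scal_def)
qed

lemma rotor_coeff:
  assumes "s \<in> set sign_patterns" "i < 4" "plane_pairs m P ! i = (a, b)"
  shows "rotor m P s {a, b} = s ! i / 4"
proof -
  have "((a, b), s ! i) \<in> set (zip (plane_pairs m P) s)"
    using assms length_plane_pairs_eq_length_signs[OF assms(1)] length_sign_pattern[OF assms(1)]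
    by (auto simp: set_zip intro!: exI[of _ i])
  then show ?thesis
    using rot_prod_coeff disjoint_planes
    by (simp add: rotor_pairing_eq_rot_prod[OF assms(1)] scal_def)
qed

lemma inj_on_rotor_signs: "inj_on (rotor m P) (set sign_patterns)"
proof (rule inj_onI)
  fix s t assume s: "s \<in> set sign_patterns" "t \<in> set sign_patterns" "rotor m P s = rotor m P t"
  have "s ! i = t ! i" if "i < 4" for i
    using rotor_coeff[OF s(1) that] rotor_coeff[OF s(2) that] s(3)
    by (cases "plane_pairs m P ! i") simp
  then show "s = t"
    using length_sign_pattern s(1,2) by (intro nth_equalityI) simp_all
qed

end

subsection \<open>The invariants\<close>

lemma sorted_affine_hyperplane_props:
  assumes "A \<in> affine_hyperplanes"
  shows "distinct (sorted_list_of_set A)" "length (sorted_list_of_set A) = 8"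
    "set (sorted_list_of_set A) \<subseteq> {1..15}"
  unfolding set_sorted_affine_hyperplane[OF assms] length_sorted_affine_hyperplane[OF assms]
  using assms affine_hyperplanes_subset by auto

context
  fixes A :: "nat set" and P :: "(nat \<times> nat) list" and s :: "real list"
  assumes A: "A \<in> affine_hyperplanes" and P: "P \<in> set pairings" and s: "s \<in> set sign_patterns"
begin

lemma rotor_permutes_PhiTerms:
  obtains f where "bij_betw f (set PhiTerms) (set PhiTerms)"
    "\<forall>T\<in>set PhiTerms. carries_blade (rotor (sorted_list_of_set A) P s) T (f T)"
proof -
  let ?m = "sorted_list_of_set A"
  obtain u d where direction: "u \<in> {1..15}" "\<not> gf2_dot u d" "d \<le> 15"
    and transvection: "\<And>x. x \<in> {1..15} \<Longrightarrow> transposes (plane_pairs ?m P) x = transvection u d x"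
    using transposes_pairing_eq_transvection[OF A P] by blast
  have "carries_blade (rotor ?m P s) T (transvection u d ` T)" if "T \<in> set PhiTerms" for T
  proof -
    have T: "T \<subseteq> {1..15}" using that PhiTerms_subset by blast
    then have "transposes (plane_pairs ?m P) ` T = transvection u d ` T"
      by (intro image_cong transvection) blast+
    then show ?thesis
      using rotor_carries_blade[OF sorted_affine_hyperplane_props[OF A] P s T] by simp
  qed
  then show thesis
    using that bij_betw_transvection_hyperplanes[OF direction] unfolding set_PhiTerms by blast
qed

lemma rotor_conj_Phi:
  "\<exists>S\<in>Cl15. clmul (rotor (sorted_list_of_set A) P s) S = clone
    \<and> clmul S (rotor (sorted_list_of_set A) P s) = clone
    \<and> (\<exists>\<eta>::nat \<Rightarrow> real. (\<forall>k<15. \<eta> k = 1 \<or> \<eta> k = -1)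
      \<and> clmul (clmul (rotor (sorted_list_of_set A) P s) Phi) S
        = (\<lambda>C. \<Sum>k<15. \<eta> k * blade (PhiTerms ! k) C))"
proof -
  let ?R = "rotor (sorted_list_of_set A) P s"
  have "?R \<in> Cl15_units"
    using sorted_affine_hyperplane_props[OF A] P s by (rule rotor_in_Cl15_units)
  then obtain S where inverse: "S \<in> Cl15" "clmul ?R S = clone" "clmul S ?R = clone"
    unfolding Cl15_units_def by blast
  obtain f where bij: "bij_betw f (set PhiTerms) (set PhiTerms)"
    and carries: "\<forall>T\<in>set PhiTerms. carries_blade ?R T (f T)"
    using rotor_permutes_PhiTerms .
  obtain \<eta> where sign: "\<forall>T\<in>set PhiTerms. \<eta> T \<in> {1, -1}"
    and conjugate: "clmul (clmul ?R Phi) S = (\<Sum>T\<in>set PhiTerms. scal (\<eta> T) (blade T))"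
    unfolding Phi_eq_sum_blades
    using conj_sum_blades[OF bij PhiTerms_subset carries inverse(1,2)] .
  have "clmul (clmul ?R Phi) S = (\<lambda>C. \<Sum>k<15. \<eta> (PhiTerms ! k) * blade (PhiTerms ! k) C)"
    unfolding conjugate
    by (rule ext) (simp only: sum_fun_apply scal_def sum_PhiTerms_nth[of "\<lambda>T. \<eta> T * blade T _"])
  moreover have "\<forall>k<15. \<eta> (PhiTerms ! k) = 1 \<or> \<eta> (PhiTerms ! k) = -1"
    using sign by (simp add: length_PhiTerms)
  ultimately show ?thesis
    using inverse
    by (intro bexI[of _ S] conjI exI[of _ "\<lambda>k. \<eta> (PhiTerms ! k)"])
qed

end

lemma inj_on_primary_invariants:
  "inj_on (\<lambda>(A, P). planes (sorted_list_of_set A) P) (affine_hyperplanes \<times> set pairings)"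
proof (intro inj_onI, clarsimp)
  fix A P B Q
  assume A: "A \<in> affine_hyperplanes" "B \<in> affine_hyperplanes"
    and P: "P \<in> set pairings" "Q \<in> set pairings"
    and eq: "planes (sorted_list_of_set A) P = planes (sorted_list_of_set B) Q"
  note A_list = sorted_affine_hyperplane_props[OF A(1)]
    and B_list = sorted_affine_hyperplane_props[OF A(2)]
  have "\<Union> (planes (sorted_list_of_set A) P) = A" "\<Union> (planes (sorted_list_of_set B) Q) = B"
    using Union_planes[OF P(1) A_list(1,2)] Union_planes[OF P(2) B_list(1,2)] A
    by (simp_all only: set_sorted_affine_hyperplane)
  with eq have "A = B" by simp
  moreover from this have "P = Q"
    using eq P inj_on_planes[OF A_list(1,2)] by (simp add: inj_on_eq_iff)
  ultimately show "A = B \<and> P = Q" ..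
qed

lemma inj_on_signed_invariants:
  "inj_on (\<lambda>(A, P, s). rotor (sorted_list_of_set A) P s)
    (affine_hyperplanes \<times> set pairings \<times> set sign_patterns)"
proof (intro inj_onI, clarsimp)
  fix A P s B Q t
  assume A: "A \<in> affine_hyperplanes" "B \<in> affine_hyperplanes"
    and P: "P \<in> set pairings" "Q \<in> set pairings"
    and s: "s \<in> set sign_patterns" "t \<in> set sign_patterns"
    and eq: "rotor (sorted_list_of_set A) P s = rotor (sorted_list_of_set B) Q t"
  note A_list = sorted_affine_hyperplane_props[OF A(1)]
    and B_list = sorted_affine_hyperplane_props[OF A(2)]
  have "planes (sorted_list_of_set A) P = planes (sorted_list_of_set B) Q"
    unfolding planes_eq_rotor_support[OF A_list P(1) s(1)]
      planes_eq_rotor_support[OF B_list P(2) s(2)] eq ..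
  then have "A = B" "P = Q"
    using inj_onD[OF inj_on_primary_invariants, of "(A, P)" "(B, Q)"] A P by simp_all
  moreover from this have "s = t"
    using inj_on_rotor_signs[OF A_list P(1)] eq s by (simp add: inj_on_eq_iff)
  ultimately show "A = B \<and> P = Q \<and> s = t" by simp
qed

theorem theorem3:
  shows "(\<forall>A. PhiStar A \<noteq> 0 \<longrightarrow> (\<forall>P\<in>set pairings. \<forall>s\<in>set sign_patterns.
            (\<exists>S\<in>Cl15. clmul (rotor (sorted_list_of_set A) P s) S = clone
                    \<and> clmul S (rotor (sorted_list_of_set A) P s) = clone
                    \<and> (\<exists>\<eta>::nat \<Rightarrow> real. (\<forall>k<15. \<eta> k = 1 \<or> \<eta> k = -1) \<and>
                         clmul (clmul (rotor (sorted_list_of_set A) P s) Phi) S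
                           = (\<lambda>C. \<Sum>k<15. \<eta> k * blade (PhiTerms ! k) C)))))
       \<and> card {planes (sorted_list_of_set A) P | A P. PhiStar A \<noteq> 0 \<and> P \<in> set pairings} = 105
       \<and> card {rotor (sorted_list_of_set A) P s | A P s.
                 PhiStar A \<noteq> 0 \<and> P \<in> set pairings \<and> s \<in> set sign_patterns} = 420"
  (is "?Conj \<and> card ?Planes = 105 \<and> card ?Rotors = 420")
proof (intro conjI)
  show ?Conj
    using rotor_conj_Phi unfolding PhiStar_nonzero_iff by blast
  have "?Planes = (\<lambda>(A, P). planes (sorted_list_of_set A) P) ` (affine_hyperplanes \<times> set pairings)"
    unfolding PhiStar_nonzero_iff by (force simp: image_iff)
  then show "card ?Planes = 105"
    by (simp only: card_image inj_on_primary_invariants card_cartesian_product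
        card_affine_hyperplanes card_pairings)
  have "?Rotors = (\<lambda>(A, P, s). rotor (sorted_list_of_set A) P s)
      ` (affine_hyperplanes \<times> set pairings \<times> set sign_patterns)"
    unfolding PhiStar_nonzero_iff by (force simp: image_iff)
  then show "card ?Rotors = 420"
    by (simp only: card_image inj_on_signed_invariants card_cartesian_product
        card_affine_hyperplanes card_pairings card_sign_patterns)
qed

end
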